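(* For every $m\in\mathbb{Z}_{+}=\mathbb{N}\cup\{0\}$ and every $x\in\mathbb{R}$ with $0\le x<1$, $$E_m(x)=2\,m!\sum_{n=-\infty}^{\infty}\frac{e^{(2n+1)\pi i x}}{\left((2n+1)\pi i\right)^{m+1}}.$$
   Context: The Euler polynomials $E_n(x)$, $n\ge 0$, are defined by the Taylor series expansion in $t$ (about $t=0$) $$\frac{2}{e^t+1}e^{xt}=\sum_{n=0}^{\infty}E_n(x)\frac{t^n}{n!},\qquad x\in\mathbb{R}.$$ For $x\in\mathbb{R}$ with $0\le x<1$ the Euler polynomials $E_n(x)$ are called the Euler functions; in the claim $E_m(x)$ denotes the Euler function. Here $i=\sqrt{-1}$.
   Formalization: The single point m = 0, x = 0 is excluded, because there E_0(0) = 1 while the series of 1/((2n+1)πi) has symmetric partial sums tending to 0 and diverges when its two ends are cut off independently. *)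

theory Defs
  imports "HOL-Analysis.Analysis" "HOL-Real_Asymp.Real_Asymp"
begin

(* E_n(x) is n! times the n-th Taylor coefficient at t = 0 of the generating function,
   i.e. its n-th derivative there. *)
definition euler_poly :: "nat \<Rightarrow> real \<Rightarrow> real" where
  "euler_poly n x = (deriv ^^ n) (\<lambda>t. 2 / (exp t + 1) * exp (x * t)) 0"

(* Convergence of a series over the integers: the two cut-off points tend to infinity
   independently of each other. Absolute convergence is not required. *)
definition bilateral_sums :: "(int \<Rightarrow> 'a::{topological_space, comm_monoid_add}) \<Rightarrow> 'a \<Rightarrow> bool"
    (infixr "bilateral'_sums" 80) where
  "f bilateral_sums s \<longleftrightarrow>
     ((\<lambda>(M, N). \<Sum>n = - int M..int N. f n) \<longlongrightarrow> s) (sequentially \<times>\<^sub>F sequentially)"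

lemma bilateral_sums_imp_symmetric_limit:
  assumes "f bilateral_sums s"
  shows "(\<lambda>N. \<Sum>n = - int N..int N. f n) \<longlonglongrightarrow> s"
proof -
  have "filterlim (\<lambda>N::nat. (N, N)) (sequentially \<times>\<^sub>F sequentially) sequentially"
    by (intro filterlim_Pair filterlim_ident)
  from filterlim_compose[OF assms[unfolded bilateral_sums_def] this] show ?thesis
    by simp
qed

lemma has_fps_expansion_imp_higher_deriv:
  fixes f :: "real \<Rightarrow> real"
  assumes "f has_fps_expansion F"
  shows "(deriv ^^ n) f has_fps_expansion (fps_deriv ^^ n) F"
  by (induction n) (auto intro!: has_fps_expansion_deriv assms)

lemma euler_poly_generating_function:
  "(\<lambda>t. 2 / (exp t + 1) * exp (x * t)) has_fps_expansion
     Abs_fps (\<lambda>n. euler_poly n x / fact n)"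
proof -
  define f where "f = (\<lambda>t. 2 / (exp t + 1) * exp (x * t))"
  define F where "F = 2 / (fps_exp 1 + 1) * fps_exp x"
  have f: "f has_fps_expansion F"
    unfolding f_def F_def by (intro fps_expansion_intros) auto
  have "F = Abs_fps (\<lambda>n. euler_poly n x / fact n)"
  proof (rule fps_ext)
    fix n
    have "\<forall>\<^sub>F t in nhds 0. eval_fps ((fps_deriv ^^ n) F) t = (deriv ^^ n) f t"
      using has_fps_expansion_imp_higher_deriv[OF f] by (simp add: has_fps_expansion_def)
    hence "fps_nth ((fps_deriv ^^ n) F) 0 = (deriv ^^ n) f 0"
      by (auto dest: eventually_nhds_x_imp_x simp: eval_fps_at_0)
    also have "\<dots> = euler_poly n x"
      by (simp only: euler_poly_def f_def)
    finally show "fps_nth F n = fps_nth (Abs_fps (\<lambda>n. euler_poly n x / fact n)) n"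
      by (simp add: fps_0th_higher_deriv field_simps)
  qed
  with f show ?thesis by (simp add: f_def)
qed

(* For m = 0 and x = 0 the series has the terms 1 / ((2 n + 1) \<pi> i), whose symmetric
   partial sums tend to 0, although E_0(0) = 1. *)
lemma symmetric_sums_at_0:
  "(\<lambda>N. \<Sum>n = - int N..int N. 1 / (of_int (2 * n + 1) * of_real pi * \<i>)) \<longlonglongrightarrow> 0"
proof -
  have real_sum: "(\<Sum>n = - int N..int N. 1 / (2 * real_of_int n + 1)) = 1 / (2 * real N + 1)" for N
  proof (induction N)
    case (Suc N)
    have "{- int (Suc N)..int (Suc N)}
        = insert (- int (Suc N)) (insert (int (Suc N)) {- int N..int N})" by auto
    hence "(\<Sum>n = - int (Suc N)..int (Suc N). 1 / (2 * real_of_int n + 1))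
        = 1 / (- (2 * real N + 1)) + (1 / (2 * real (Suc N) + 1) + 1 / (2 * real N + 1))"
      using Suc by simp
    thus ?case by (simp add: minus_divide_right[symmetric] del: minus_add_distrib)
  qed auto
  have "(\<Sum>n = - int N..int N. 1 / (of_int (2 * n + 1) * of_real pi * \<i>))
      = 1 / (of_real pi * \<i>) * of_real (1 / (2 * real N + 1))" for N
    unfolding real_sum[symmetric] by (simp add: sum_distrib_left mult_ac)
  moreover have "(\<lambda>N. 1 / (of_real pi * \<i>) * of_real (1 / (2 * real N + 1))) \<longlonglongrightarrow>
      1 / (of_real pi * \<i>) * of_real 0"
    by (intro tendsto_intros tendsto_of_real) real_asymp
  ultimately show ?thesis by simp
qed

lemma euler_poly_0: "euler_poly 0 x = 1"
  by (simp add: euler_poly_def)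

end

theory Submission
  imports Defs
begin

text \<open>
  Put \<open>a n = (2 n + 1) \<pi> i\<close>, so that \<open>exp (a n) = -1\<close> for every integer \<open>n\<close>. The proof rests
  on a structure that both sides share. With \<open>P m = E m / m!\<close>, the generating function gives
  \<open>P (m + 1)' = P m\<close> and, for \<open>m \<ge> 1\<close>, the antiperiodicity \<open>P m 1 = - P m 0\<close>
  (\<open>appell_euler_deriv\<close>, \<open>appell_euler_antiperiodic\<close>). The partial sums
  \<open>T m = (\<Sum>n = -M..N. exp (a n * x) / a n ^ (m + 1))\<close> obey the same two rules. An antiperiodic function
  on the unit interval is controlled by its derivative, because antiperiodicity fixes the constant of
  integration. Hence, if the error \<open>T m - P m / 2\<close> tends to \<open>0\<close> uniformly on \<open>[0, 1]\<close>, so does the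
  next one (\<open>remainder_uniform_step\<close>).

  The induction cannot start at \<open>m = 0\<close>: there the series converges only conditionally, to a function
  that jumps at the endpoints. On the open interval, its value is settled as follows
  (\<open>mode_sum_0_locally_uniform\<close>). The derivative of \<open>T 0\<close> is a geometric sum, equal to two waves of
  frequency about \<open>N\<close> and \<open>M\<close> times the fixed smooth factor \<open>1 / (2 i sin (\<pi> x))\<close>. Integrating the fast
  waves by parts shows that \<open>T 0\<close> becomes constant, uniformly on compact subintervals, as
  \<open>M\<close> and \<open>N\<close> grow; at \<open>x = 1/2\<close> the series is twice the Leibniz series for \<open>\<pi> / 4\<close>, divided by
  \<open>\<pi>\<close>, so the constant is \<open>1/2\<close>.

  The case \<open>m = 1\<close> bridges the two regimes (\<open>remainder_1_uniform\<close>). By comparison with the sum of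
  inverse squares, its error converges uniformly on \<open>[0, 1]\<close> to some continuous function. This function is
  constant on the open interval by the case \<open>m = 0\<close>, hence constant on \<open>[0, 1]\<close>, and an
  antiperiodic constant vanishes.
\<close>

section \<open>The Appell structure of the Euler polynomials\<close>

lemma has_fps_expansion_imp_fps_nth:
  fixes f :: "real \<Rightarrow> real"
  assumes "f has_fps_expansion F"
  shows "fps_nth F n = (deriv ^^ n) f 0 / fact n"
proof -
  have "\<forall>\<^sub>F t in nhds 0. eval_fps ((fps_deriv ^^ n) F) t = (deriv ^^ n) f t"
    using has_fps_expansion_imp_higher_deriv[OF assms] by (simp add: has_fps_expansion_def)
  hence "fps_nth ((fps_deriv ^^ n) F) 0 = (deriv ^^ n) f 0"
    by (auto dest: eventually_nhds_x_imp_x simp: eval_fps_at_0)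
  thus ?thesis
    by (simp add: fps_0th_higher_deriv field_simps)
qed

text \<open>
  Dividing by the factorial removes the factor \<open>n\<close> from the rule \<open>E n' = n E (n - 1)\<close>, so that
  differentiation acts exactly as it does on the exponential sums.
\<close>
definition appell_euler :: "nat \<Rightarrow> real \<Rightarrow> real" where
  "appell_euler n x = euler_poly n x / fact n"

lemma appell_euler_fps:
  "appell_euler n x = fps_nth (2 / (fps_exp 1 + 1) * fps_exp x) n"
proof -
  have "(\<lambda>t. 2 / (exp t + 1) * exp (x * t)) has_fps_expansion 2 / (fps_exp 1 + 1) * fps_exp x"
    by (intro fps_expansion_intros) auto
  from has_fps_expansion_imp_fps_nth[OF this, of n] show ?thesis
    by (simp add: appell_euler_def euler_poly_def)
qed

lemma appell_euler_0 [simp]: "appell_euler 0 x = 1"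
  by (simp add: appell_euler_def euler_poly_0)

text \<open>
  The generating function splits into a factor free of \<open>x\<close> and \<open>exp (x t)\<close>. The Cauchy product therefore
  writes each polynomial as a combination of the divided powers \<open>x ^ j / j!\<close>, which differentiate
  into each other.
\<close>
lemma appell_euler_deriv:
  "(appell_euler (Suc n) has_real_derivative appell_euler n x) (at x within A)"
proof -
  define c where "c = fps_nth (2 / (fps_exp 1 + 1) :: real fps)"
  have expand: "appell_euler n = (\<lambda>x. \<Sum>k\<le>n. c k * (x ^ (n - k) / fact (n - k)))" for n
    by (simp add: fun_eq_iff appell_euler_fps c_def fps_mult_nth atMost_atLeast0)
  have pow: "((\<lambda>x. x ^ Suc j / fact (Suc j)) has_real_derivative x ^ j / fact j) (at x within A)" for j
    by (rule derivative_eq_intros refl | simp add: field_simps del: of_nat_Suc)+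
  have "((\<lambda>x. (\<Sum>k\<le>n. c k * (x ^ Suc (n - k) / fact (Suc (n - k)))) + c (Suc n))
      has_real_derivative (\<Sum>k\<le>n. c k * (x ^ (n - k) / fact (n - k))) + 0) (at x within A)"
    by (intro DERIV_add DERIV_sum DERIV_cmult pow DERIV_const)
  moreover have "appell_euler (Suc n)
      = (\<lambda>x. (\<Sum>k\<le>n. c k * (x ^ Suc (n - k) / fact (Suc (n - k)))) + c (Suc n))"
    unfolding expand by (auto simp: fun_eq_iff Suc_diff_le intro!: sum.cong)
  ultimately show ?thesis
    by (simp add: expand)
qed

text \<open>
  Adding the generating functions at \<open>0\<close> and \<open>1\<close> cancels the denominator \<open>exp t + 1\<close> and leaves the
  constant \<open>2\<close>, which has no coefficients of positive degree.
\<close>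
lemma appell_euler_antiperiodic: "appell_euler (Suc n) 1 = - appell_euler (Suc n) 0"
proof -
  let ?D = "fps_exp 1 + 1 :: real fps"
  have "2 / ?D * fps_exp 1 + 2 / ?D * fps_exp 0 = 2 / ?D * ?D"
    by (simp add: algebra_simps)
  also have "\<dots> = 2"
    by (simp add: fps_divide_unit mult.assoc inverse_mult_eq_1)
  finally have "fps_nth (2 / ?D * fps_exp 1 + 2 / ?D * fps_exp 0) (Suc n) = 0"
    by (simp add: fps_numeral_nth)
  thus ?thesis
    by (simp add: appell_euler_fps)
qed

section \<open>Two-sided partial sums of the exponential series\<close>

definition freq :: "int \<Rightarrow> complex" where
  "freq n = of_int (2 * n + 1) * of_real pi * \<i>"

definition mode :: "nat \<Rightarrow> int \<Rightarrow> real \<Rightarrow> complex" where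
  "mode m n x = exp (freq n * of_real x) / freq n ^ (m + 1)"

definition mode_sum :: "nat \<Rightarrow> nat \<times> nat \<Rightarrow> real \<Rightarrow> complex" where
  "mode_sum m = (\<lambda>(M, N) x. \<Sum>n = - int M..int N. mode m n x)"

lemma freq_nonzero [simp]: "freq n \<noteq> 0"
proof -
  have "2 * n + 1 \<noteq> 0" by presburger
  hence "of_int (2 * n + 1) \<noteq> (0 :: complex)" by (subst of_int_eq_0_iff)
  thus ?thesis by (simp add: freq_def)
qed

lemma freq_reflect: "freq (- int k - 1) = cnj (freq (int k))"
  by (simp add: freq_def algebra_simps)

lemma mode_reflect: "mode m (- int k - 1) x = cnj (mode m (int k) x)"
  by (simp add: mode_def freq_reflect exp_cnj)

text \<open>
  A bilateral sum is cut between \<open>-1\<close> and \<open>0\<close>, since \<open>k\<close> and \<open>- k - 1\<close> have opposite frequencies: the two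
  halves are then complex conjugates of each other, and one-sided convergence theorems apply to both.
\<close>
lemma sum_int_interval_split:
  fixes f :: "int \<Rightarrow> 'a :: ab_group_add"
  shows "(\<Sum>n = - int M..int N. f n) = (\<Sum>k<Suc N. f (int k)) + (\<Sum>k<M. f (- int k - 1))"
proof -
  have "(\<Sum>k<Suc N. f (int k)) = sum f {0..int N}"
    by (rule sum.reindex_bij_witness[of _ nat int]) auto
  moreover have "(\<Sum>k<M. f (- int k - 1)) = sum f {- int M..-1}"
    by (rule sum.reindex_bij_witness[of _ "\<lambda>n. nat (- n - 1)" "\<lambda>k. - int k - 1"]) auto
  moreover have "{- int M..int N} = {0..int N} \<union> {- int M..-1}" by auto
  ultimately show ?thesis by (simp add: sum.union_disjoint)
qed

lemma mode_sum_split: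
  "mode_sum m p x = (\<Sum>k<Suc (snd p). mode m (int k) x) + cnj (\<Sum>k<fst p. mode m (int k) x)"
  by (cases p) (simp add: mode_sum_def sum_int_interval_split mode_reflect del: sum.lessThan_Suc)

lemma exp_freq_1: "exp (freq n) = -1"
proof -
  have "freq n = of_int n * (of_real (2 * pi) * \<i>) + of_real pi * \<i>"
    by (simp add: freq_def algebra_simps)
  moreover have "exp (of_int n * (of_real (2 * pi) * \<i>)) = 1"
    using exp_integer_2pi[of "of_int n"] by (simp add: mult_ac)
  ultimately show ?thesis by (simp add: exp_add)
qed

lemma mode_sum_antiperiodic: "mode_sum m p 1 = - mode_sum m p 0"
  by (cases p) (simp add: mode_sum_def mode_def exp_freq_1 sum_negf[symmetric])

lemma exp_cmult_has_vector_derivative: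
  "((\<lambda>x. exp (c * complex_of_real x)) has_vector_derivative c * exp (c * of_real x)) (at x within A)"
proof -
  have "((\<lambda>z. exp (c * z)) has_field_derivative c * exp (c * of_real x))
      (at (of_real x))"
    by (auto intro!: derivative_eq_intros)
  from has_vector_derivative_real_field[OF this] show ?thesis by (simp add: o_def)
qed

lemma exp_over_power_has_vector_derivative:
  assumes "c \<noteq> 0"
  shows "((\<lambda>x. exp (c * complex_of_real x) / c ^ (k + 1)) has_vector_derivative
    exp (c * of_real x) / c ^ k) (at x within A)"
proof -
  have "((\<lambda>x. exp (c * complex_of_real x) / c ^ (k + 1)) has_vector_derivative
      c * exp (c * of_real x) / c ^ (k + 1)) (at x within A)"
    by (intro has_vector_derivative_divide exp_cmult_has_vector_derivative)
  thus ?thesis using assms by simp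
qed

lemma mode_sum_deriv:
  "(mode_sum (Suc m) p has_vector_derivative mode_sum m p x) (at x within A)"
  using exp_over_power_has_vector_derivative[OF freq_nonzero, where k = "m + 1"]
  by (cases p) (auto simp: mode_sum_def mode_def[abs_def] intro!: has_vector_derivative_sum)

lemma mode_sum_0_deriv:
  "(mode_sum 0 (M, N) has_vector_derivative
      (\<Sum>n = - int M..int N. exp (freq n * of_real x))) (at x within A)"
  using exp_over_power_has_vector_derivative[OF freq_nonzero, where k = 0]
  by (auto simp: mode_sum_def mode_def[abs_def] intro!: has_vector_derivative_sum)

lemma norm_diff_le_of_vector_derivative_bound:
  fixes f :: "real \<Rightarrow> 'a :: real_normed_vector"
  assumes "\<And>t. t \<in> {u..v} \<Longrightarrow> (f has_vector_derivative f' t) (at t within {u..v})"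
    and "\<And>t. t \<in> {u..v} \<Longrightarrow> norm (f' t) \<le> B"
    and "x \<in> {u..v}" and "y \<in> {u..v}"
  shows "norm (f x - f y) \<le> B * \<bar>x - y\<bar>"
proof -
  have "onorm (\<lambda>h. h *\<^sub>R f' t) \<le> B" if "t \<in> {u..v}" for t
    using onorm_scaleR_left[OF bounded_linear_ident, of "f' t"] assms(2)[OF that]
    by (simp add: onorm_id)
  from differentiable_bound[OF _ assms(1)[unfolded has_vector_derivative_def] this assms(3,4)]
  show ?thesis by simp
qed

section \<open>The square wave\<close>

text \<open>
  Multiplication by \<open>2 i sin (\<pi> x) = exp (\<pi> i x) - exp (- \<pi> i x)\<close> makes the sum telescope, because the
  frequencies are the odd multiples of \<open>\<pi> i\<close>.
\<close>
lemma exp_sum_closed_form: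
  assumes "sin (pi * x) \<noteq> 0"
  shows "(\<Sum>n = - int M..int N. exp (freq n * of_real x))
    = (exp (of_real (2 * pi * real (Suc N)) * \<i> * of_real x)
        - exp (- of_real (2 * pi * real M) * \<i> * of_real x)) * of_real (inverse (sin (pi * x))) / (2 * \<i>)"
proof -
  define g :: "int \<Rightarrow> complex" where "g n = exp (of_real (2 * pi * of_int n) * \<i> * of_real x)" for n
  define s :: complex where "s = of_real (sin (pi * x)) * (2 * \<i>)"
  have s: "s \<noteq> 0" using assms by (simp add: s_def)
  have s_exp: "s = exp (of_real pi * \<i> * of_real x) - exp (- (of_real pi * \<i> * of_real x))"
    by (simp add: s_def sin_of_real[symmetric] sin_exp_eq mult_ac)
  have step: "exp (freq n * of_real x) * s = g (n + 1) - g n" for n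
    by (simp add: s_exp g_def freq_def right_diff_distrib exp_add[symmetric] algebra_simps)
  have "(\<Sum>n = - int M..int N. exp (freq n * of_real x)) * s = (\<Sum>n = - int M..int N. g (n + 1) - g n)"
    by (simp add: sum_distrib_right step)
  also have "\<dots> = g (int (Suc N)) - g (- int M)"
  proof -
    have "(\<Sum>k<Suc N. g (int k + 1) - g (int k)) = g (int (Suc N)) - g 0"
      using sum_lessThan_telescope[of "\<lambda>k. g (int k)" "Suc N"] by (simp add: add.commute)
    moreover have "(\<Sum>k<M. g (- int k - 1 + 1) - g (- int k - 1)) = g 0 - g (- int M)"
    proof -
      have shift: "- int k - 1 = - int (Suc k)" "- int (Suc k) + 1 = - int k" for k by simp_all
      show ?thesis
        using sum_lessThan_telescope'[of "\<lambda>k. g (- int k)" M]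
        by (simp only: shift of_nat_0 minus_zero)
    qed
    ultimately show ?thesis
      by (simp only: sum_int_interval_split) simp
  qed
  finally show ?thesis
    using s by (simp add: g_def s_def field_simps)
qed

lemma mode_0_at_half: "mode 0 (int k) (1/2) = of_real ((-1) ^ k / real (k * 2 + 1) / pi)"
proof -
  have "exp (freq (int k) * of_real (1/2)) = exp (of_real (pi / 2) * \<i>) * exp (of_nat k * (of_real pi * \<i>))"
    by (simp add: freq_def exp_add[symmetric] algebra_simps)
  also have "\<dots> = \<i> * (-1) ^ k"
    by (simp only: exp_of_nat_mult exp_pi_i exp_pi_i' cis_conv_exp[symmetric] mult.commute[of _ \<i>] cis_pi_half cis_pi)
  finally have num: "exp (freq (int k) * of_real (1/2)) = \<i> * (-1) ^ k" .
  have den: "freq (int k) = \<i> * of_real (real (k * 2 + 1) * pi)"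
    by (simp add: freq_def algebra_simps)
  have "mode 0 (int k) (1/2) = exp (freq (int k) * of_real (1/2)) / freq (int k)"
    by (simp add: mode_def)
  also have "\<dots> = \<i> * (-1) ^ k / (\<i> * of_real (real (k * 2 + 1) * pi))"
    by (subst num, subst den) (rule refl)
  also have "\<dots> = of_real ((-1) ^ k / (real (k * 2 + 1) * pi))"
    by (subst mult_divide_mult_cancel_left) simp_all
  finally show ?thesis
    by (simp only: divide_divide_eq_left)
qed

text \<open>
  Each one-sided half of the series is the Leibniz series divided by \<open>\<pi>\<close> and contributes \<open>1/4\<close>.
\<close>
lemma mode_sum_0_at_half:
  "((\<lambda>p. mode_sum 0 p (1/2)) \<longlongrightarrow> 1/2) (sequentially \<times>\<^sub>F sequentially)"
proof -
  have "summable (\<lambda>k. (-1) ^ k * (1 / real (k * 2 + 1)) :: real)"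
    using summable_arctan_series[of 1] by simp
  hence "(\<lambda>k. (-1) ^ k / real (k * 2 + 1)) sums (pi / 4)"
    using pi_series by (simp add: sums_iff)
  hence "(\<lambda>k. (-1) ^ k / real (k * 2 + 1) / pi) sums (pi / 4 / pi)"
    by (rule sums_divide)
  hence "(\<lambda>k. mode 0 (int k) (1/2)) sums of_real (1/4)"
    unfolding mode_0_at_half by (intro sums_of_real) simp
  hence lim: "(\<lambda>n. \<Sum>k<n. mode 0 (int k) (1/2)) \<longlonglongrightarrow> of_real (1/4)"
    by (simp add: sums_def)
  have "((\<lambda>p. (\<Sum>k<Suc (snd p). mode 0 (int k) (1/2)) + cnj (\<Sum>k<fst p. mode 0 (int k) (1/2)))
      \<longlongrightarrow> of_real (1/4) + cnj (of_real (1/4))) (sequentially \<times>\<^sub>F sequentially)"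
    by (intro tendsto_add tendsto_cnj filterlim_compose[OF lim]
          filterlim_compose[OF filterlim_Suc] filterlim_fst filterlim_snd)
  thus ?thesis
    unfolding mode_sum_split by simp
qed

lemma uniform_limit_of_bound:
  fixes f :: "'a \<Rightarrow> 'b \<Rightarrow> 'c :: real_normed_vector"
  assumes "\<forall>\<^sub>F p in F. \<forall>x\<in>A. norm (f p x - g x) \<le> b p" and "(b \<longlongrightarrow> 0) F"
  shows "uniform_limit A f g F"
proof (rule uniform_limitI)
  fix e :: real assume "0 < e"
  with assms(2) have "\<forall>\<^sub>F p in F. b p < e" by (rule order_tendstoD)
  with assms(1) show "\<forall>\<^sub>F p in F. \<forall>x\<in>A. dist (f p x) (g x) < e"
    by eventually_elim (force simp: dist_norm)
qed

lemma interior_margin: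
  fixes x :: real
  assumes "0 < x" "x < 1"
  obtains d where "0 < d" "d < 1/2" "x \<in> {d..1-d}"
proof
  define d where "d = min x (1 - x) / 2"
  have "d \<le> x / 2" "d \<le> (1 - x) / 2" by (simp_all add: d_def)
  moreover show "0 < d" using assms by (simp add: d_def)
  ultimately show "d < 1/2" "x \<in> {d..1-d}" using assms by auto
qed

text \<open>
  This is integration by parts, in a form that needs no integral. The derivative of the partial sum is
  \<open>w' h / (2 i)\<close>, where \<open>h = 1 / sin (\<pi> x)\<close> is smooth away from the endpoints and the primitive \<open>w\<close> of the two
  fast waves is of size \<open>1 / N + 1 / M\<close>. Subtracting \<open>k = w h / (2 i)\<close> leaves a function whose
  derivative contains \<open>w\<close> but not \<open>w'\<close>, so the mean value inequality bounds its variation.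
\<close>
lemma mode_sum_0_oscillation_bound:
  assumes d: "0 < d" "d < 1/2"
  obtains C where "\<And>M N x. 0 < M \<Longrightarrow> x \<in> {d..1-d} \<Longrightarrow>
    norm (mode_sum 0 (M, N) x - mode_sum 0 (M, N) (1/2)) \<le> C * (1 / real (Suc N) + 1 / real M)"
proof -
  define h where "h x = inverse (sin (pi * x))" for x :: real
  define h' where "h' x = - (pi * cos (pi * x)) / (sin (pi * x))\<^sup>2" for x :: real
  have sin_nz: "sin (pi * x) \<noteq> 0" if "x \<in> {d..1-d}" for x
  proof -
    have "0 < pi * x" "pi * x < pi * 1"
      using that d by (auto intro!: mult_strict_left_mono)
    thus ?thesis using sin_gt_zero[of "pi * x"] by simp
  qed
  have h_deriv: "(h has_real_derivative h' x) (at x within {d..1-d})" if "x \<in> {d..1-d}" for x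
    unfolding h_def h'_def using sin_nz[OF that]
    by (auto intro!: derivative_eq_intros simp: power2_eq_square field_simps)
  have "bounded (h ` {d..1-d})" "bounded (h' ` {d..1-d})"
    unfolding h_def h'_def using sin_nz
    by (intro compact_imp_bounded compact_continuous_image continuous_intros compact_Icc; simp)+
  then obtain A B where "\<forall>y\<in>h ` {d..1-d}. norm y \<le> A" and "\<forall>y\<in>h' ` {d..1-d}. norm y \<le> B"
    unfolding bounded_iff by blast
  hence A: "\<bar>h x\<bar> \<le> A" and B: "\<bar>h' x\<bar> \<le> B" if "x \<in> {d..1-d}" for x
    using that by auto
  have half: "1/2 \<in> {d..1-d}" using d by simp
  have AB: "0 \<le> A" "0 \<le> B" using A[OF half] B[OF half] by linarith+
  show ?thesis
  proof (rule that)
    fix M N :: nat and x :: real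
    assume M: "0 < M" and x: "x \<in> {d..1-d}"
    define \<epsilon> where "\<epsilon> = 1 / real (Suc N) + 1 / real M"
    define a b where "a = of_real (2 * pi * real (Suc N)) * \<i>" and "b = - of_real (2 * pi * real M) * \<i>"
    have ab: "a \<noteq> 0" "b \<noteq> 0" using M by (simp_all add: a_def b_def del: of_nat_Suc)
    define w where "w t = exp (a * of_real t) * (1 / a) - exp (b * of_real t) * (1 / b)" for t :: real
    have w_deriv: "(w has_vector_derivative exp (a * of_real t) - exp (b * of_real t)) (at t within T)" for t T
    proof -
      have "(w has_vector_derivative a * exp (a * of_real t) * (1 / a) - b * exp (b * of_real t) * (1 / b)) (at t within T)"
        unfolding w_def
        by (intro has_vector_derivative_diff has_vector_derivative_mult_left exp_cmult_has_vector_derivative)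
      thus ?thesis using ab by simp
    qed
    have w_bound: "norm (w t) \<le> \<epsilon>" for t
    proof -
      have small: "1 / (2 * pi * real k) \<le> 1 / real k" if "0 < k" for k
        using that pi_gt3 by (intro divide_left_mono) auto
      have "norm (w t) \<le> norm (exp (a * of_real t) * (1 / a)) + norm (exp (b * of_real t) * (1 / b))"
        unfolding w_def by (rule norm_triangle_ineq4)
      also have "\<dots> = 1 / (2 * pi * real (Suc N)) + 1 / (2 * pi * real M)"
        by (simp add: norm_mult norm_divide a_def b_def del: of_nat_Suc)
      also have "\<dots> \<le> \<epsilon>"
        unfolding \<epsilon>_def using small[of "Suc N"] small[of M] M by simp
      finally show ?thesis .
    qed
    define k where "k t = w t * of_real (h t) / (2 * \<i>)" for t
    have k_bound: "norm (k t) \<le> \<epsilon> * A" if "t \<in> {d..1-d}" for t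
    proof -
      have "norm (k t) \<le> norm (w t) * \<bar>h t\<bar>"
        by (simp add: k_def norm_mult norm_divide)
      also have "\<dots> \<le> \<epsilon> * A"
        by (rule mult_mono) (use w_bound[of t] A[OF that] in \<open>auto simp: \<epsilon>_def\<close>)
      finally show ?thesis .
    qed
    have deriv: "((\<lambda>t. mode_sum 0 (M, N) t - k t) has_vector_derivative
        - (w t * of_real (h' t) / (2 * \<i>))) (at t within {d..1-d})" if t: "t \<in> {d..1-d}" for t
    proof -
      have "((\<lambda>t. complex_of_real (h t)) has_vector_derivative of_real (h' t)) (at t within {d..1-d})"
        using h_deriv[OF t] by (intro has_vector_derivative_of_real)
          (simp add: has_real_derivative_iff_has_vector_derivative)
      from has_vector_derivative_mult[OF w_deriv this]
      have k_deriv: "(k has_vector_derivative (w t * of_real (h' t)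
          + (exp (a * of_real t) - exp (b * of_real t)) * of_real (h t)) / (2 * \<i>)) (at t within {d..1-d})"
        unfolding k_def by (intro has_vector_derivative_divide)
      have cancel: "e / (2 * \<i>) - (c + e) / (2 * \<i>) = - (c / (2 * \<i>))" for c e
        by (simp add: diff_divide_distrib[symmetric] algebra_simps)
      from has_vector_derivative_diff[OF mode_sum_0_deriv k_deriv, of M N]
      show ?thesis
        unfolding exp_sum_closed_form[OF sin_nz[OF t], of M N, folded a_def b_def h_def] cancel .
    qed
    have deriv_bound: "norm (- (w t * of_real (h' t) / (2 * \<i>))) \<le> \<epsilon> * B" if "t \<in> {d..1-d}" for t
    proof -
      have "norm (- (w t * of_real (h' t) / (2 * \<i>))) \<le> norm (w t) * \<bar>h' t\<bar>"
        by (simp add: norm_mult norm_divide)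
      also have "\<dots> \<le> \<epsilon> * B"
        by (rule mult_mono) (use w_bound[of t] B[OF that] in \<open>auto simp: \<epsilon>_def\<close>)
      finally show ?thesis .
    qed
    have "norm ((mode_sum 0 (M, N) x - k x) - (mode_sum 0 (M, N) (1/2) - k (1/2))) \<le> \<epsilon> * B * \<bar>x - 1/2\<bar>"
      by (rule norm_diff_le_of_vector_derivative_bound[OF deriv deriv_bound x half])
    also have "\<dots> \<le> \<epsilon> * B * 1"
      using x d AB by (intro mult_left_mono) (auto simp: \<epsilon>_def)
    finally have "norm (mode_sum 0 (M, N) x - mode_sum 0 (M, N) (1/2) - (k x - k (1/2))) \<le> \<epsilon> * B"
      by (simp add: algebra_simps)
    hence "norm (mode_sum 0 (M, N) x - mode_sum 0 (M, N) (1/2)) \<le> \<epsilon> * B + norm (k x - k (1/2))"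
      using norm_triangle_sub[of "mode_sum 0 (M, N) x - mode_sum 0 (M, N) (1/2)" "k x - k (1/2)"] by linarith
    also have "\<dots> \<le> \<epsilon> * B + (\<epsilon> * A + \<epsilon> * A)"
      using k_bound[OF x] k_bound[OF half] norm_triangle_ineq4[of "k x" "k (1/2)"] by linarith
    finally show "norm (mode_sum 0 (M, N) x - mode_sum 0 (M, N) (1/2))
        \<le> (2 * A + B) * (1 / real (Suc N) + 1 / real M)"
      by (simp add: \<epsilon>_def algebra_simps)
  qed
qed

lemma mode_sum_0_locally_uniform:
  assumes d: "0 < d" "d < 1/2"
  shows "uniform_limit {d..1-d} (mode_sum 0) (\<lambda>_. 1/2) (sequentially \<times>\<^sub>F sequentially)"
proof -
  obtain C where C: "\<And>M N x. 0 < M \<Longrightarrow> x \<in> {d..1-d} \<Longrightarrow>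
    norm (mode_sum 0 (M, N) x - mode_sum 0 (M, N) (1/2)) \<le> C * (1 / real (Suc N) + 1 / real M)"
    using mode_sum_0_oscillation_bound[OF d] by blast
  define b where "b p = C * (1 / real (Suc (snd p)) + 1 / real (fst p)) + norm (mode_sum 0 p (1/2) - 1/2)" for p
  show ?thesis
  proof (rule uniform_limit_of_bound)
    have "\<forall>\<^sub>F p in sequentially \<times>\<^sub>F sequentially. 0 < fst p"
      by (rule eventually_compose_filterlim[OF eventually_gt_at_top filterlim_fst])
    thus "\<forall>\<^sub>F p in sequentially \<times>\<^sub>F sequentially. \<forall>x\<in>{d..1-d}. norm (mode_sum 0 p x - 1/2) \<le> b p"
    proof eventually_elim
      case (elim p)
      show ?case
      proof
        fix x assume "x \<in> {d..1-d}"
        from C[OF elim this, of "snd p"] show "norm (mode_sum 0 p x - 1/2) \<le> b p"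
          using norm_triangle_ineq[of "mode_sum 0 p x - mode_sum 0 p (1/2)" "mode_sum 0 p (1/2) - 1/2"]
          unfolding b_def prod.collapse by simp
      qed
    qed
    have N: "(\<lambda>n. 1 / real (Suc n)) \<longlonglongrightarrow> 0" and M: "(\<lambda>n. 1 / real n) \<longlonglongrightarrow> 0"
      by real_asymp+
    have "(b \<longlongrightarrow> C * (0 + 0) + norm ((1/2 :: complex) - 1/2)) (sequentially \<times>\<^sub>F sequentially)"
      unfolding b_def
      by (intro tendsto_intros mode_sum_0_at_half filterlim_compose[OF N filterlim_snd]
            filterlim_compose[OF M filterlim_fst])
    thus "(b \<longlongrightarrow> 0) (sequentially \<times>\<^sub>F sequentially)" by simp
  qed
qed

section \<open>Integrating up: the error of the partial sums\<close>

definition remainder :: "nat \<Rightarrow> nat \<times> nat \<Rightarrow> real \<Rightarrow> complex" where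
  "remainder m p x = mode_sum m p x - of_real (appell_euler m x) / 2"

lemma remainder_deriv:
  "(remainder (Suc m) p has_vector_derivative remainder m p x) (at x within A)"
proof -
  have "((\<lambda>x. complex_of_real (appell_euler (Suc m) x)) has_vector_derivative
      of_real (appell_euler m x)) (at x within A)"
    by (intro has_vector_derivative_of_real)
      (use appell_euler_deriv in \<open>simp add: has_real_derivative_iff_has_vector_derivative\<close>)
  thus ?thesis
    unfolding remainder_def
    by (intro has_vector_derivative_diff has_vector_derivative_divide mode_sum_deriv)
qed

lemma remainder_antiperiodic: "remainder (Suc m) p 1 = - remainder (Suc m) p 0"
  by (simp add: remainder_def mode_sum_antiperiodic appell_euler_antiperiodic)

lemma uniform_limit_remainder_iff:
  "uniform_limit A (remainder m) (\<lambda>_. 0) F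
    \<longleftrightarrow> uniform_limit A (mode_sum m) (\<lambda>x. of_real (appell_euler m x) / 2) F"
  by (simp add: uniform_limit_iff remainder_def dist_norm)

text \<open>
  The variation over \<open>[0, 1]\<close> is at most \<open>B\<close>, and \<open>f 0 - f 1 = 2 f 0\<close> turns this into a bound on
  the value at \<open>0\<close>.
\<close>
lemma antiperiodic_norm_le_of_derivative:
  fixes f :: "real \<Rightarrow> 'a :: real_normed_vector"
  assumes "\<And>t. t \<in> {0..1} \<Longrightarrow> (f has_vector_derivative f' t) (at t within {0..1})"
    and "\<And>t. t \<in> {0..1} \<Longrightarrow> norm (f' t) \<le> B"
    and "f 1 = - f 0" and x: "x \<in> {0..1}"
  shows "norm (f x) \<le> 3/2 * B"
proof -
  note mvt = norm_diff_le_of_vector_derivative_bound[OF assms(1,2)]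
  have "norm (f 0 - f 1) \<le> B" using mvt[of 0 1] by simp
  hence zero: "norm (f 0) \<le> B / 2" using assms(3) by (simp add: scaleR_2[symmetric])
  have "0 \<le> B" using assms(2)[OF x] norm_ge_zero order_trans by blast
  hence "norm (f x - f 0) \<le> B" using mvt[of x 0] x mult_left_le[of x B] by simp
  with zero show ?thesis using norm_triangle_sub[of "f x" "f 0"] by linarith
qed

lemma remainder_uniform_step:
  assumes "uniform_limit {0..1} (remainder m) (\<lambda>_. 0) F"
  shows "uniform_limit {0..1} (remainder (Suc m)) (\<lambda>_. 0) F"
proof (rule uniform_limitI)
  fix e :: real assume "0 < e"
  \<comment> \<open>The factor \<open>3/2\<close> lost in passing from the derivative to the function leaves \<open>3/4 * e < e\<close>.\<close>
  hence "\<forall>\<^sub>F p in F. \<forall>x\<in>{0..1}. dist (remainder m p x) 0 < e / 2"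
    using uniform_limitD[OF assms, of "e / 2"] by simp
  thus "\<forall>\<^sub>F p in F. \<forall>x\<in>{0..1}. dist (remainder (Suc m) p x) 0 < e"
  proof eventually_elim
    case (elim p)
    show ?case
    proof
      fix x :: real assume x: "x \<in> {0..1}"
      have "norm (remainder m p t) \<le> e / 2" if "t \<in> {0..1}" for t
        using elim that by (auto intro: less_imp_le)
      from antiperiodic_norm_le_of_derivative[OF remainder_deriv this remainder_antiperiodic x]
      show "dist (remainder (Suc m) p x) 0 < e" using \<open>0 < e\<close> by simp
    qed
  qed
qed

lemma norm_mode_1_le: "norm (mode 1 (int k) x) \<le> inverse (real (Suc k) ^ 2)"
proof -
  have "real (Suc k) \<le> (2 * real k + 1) * pi"
    using pi_gt3 mult_mono[of "real (Suc k)" "2 * real k + 1" 1 pi] by simp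
  moreover have freq: "norm (freq (int k)) = (2 * real k + 1) * pi"
    unfolding freq_def using norm_of_nat[of "2 * k + 1", where 'a = complex] by (simp add: norm_mult add.commute)
  moreover have "Re (freq (int k)) = 0"
    by (simp add: freq_def)
  ultimately show ?thesis
    by (simp add: mode_def norm_divide norm_mult divide_inverse power2_eq_square[symmetric]
          norm_power norm_inverse power_mono del: of_nat_Suc)
qed

lemma remainder_1_uniformly_convergent:
  obtains r where "uniform_limit {0..1} (remainder 1) r (sequentially \<times>\<^sub>F sequentially)"
proof -
  have "summable (\<lambda>k. inverse (real (Suc k) ^ 2))"
    by (subst summable_Suc_iff) (rule inverse_power_summable, simp)
  then obtain s where s: "uniform_limit {0..1} (\<lambda>n x. \<Sum>k<n. mode 1 (int k) x) s sequentially"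
    using Weierstrass_m_test[of "{0..1}" "\<lambda>k. mode 1 (int k)", OF norm_mode_1_le] by blast
  have "uniform_limit {0..1} (\<lambda>p x. (\<Sum>k<Suc (snd p). mode 1 (int k) x) + cnj (\<Sum>k<fst p. mode 1 (int k) x)
        - of_real (appell_euler 1 x) / 2)
      (\<lambda>x. s x + cnj (s x) - of_real (appell_euler 1 x) / 2) (sequentially \<times>\<^sub>F sequentially)"
    by (intro uniform_limit_intros bounded_linear.uniform_limit[OF bounded_linear_cnj]
          filterlim_compose[OF s] filterlim_compose[OF filterlim_Suc] filterlim_fst filterlim_snd)
  hence "uniform_limit {0..1} (remainder 1) (\<lambda>x. s x + cnj (s x) - of_real (appell_euler 1 x) / 2)
      (sequentially \<times>\<^sub>F sequentially)"
    by (simp only: remainder_def[abs_def] mode_sum_split)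
  thus ?thesis by (rule that)
qed

text \<open>
  The sums for \<open>m = 0\<close> converge only locally uniformly, so the mean value inequality shows that the
  limit of the errors for \<open>m = 1\<close> is constant in the interior. Continuity of that limit carries this to
  the endpoints, where antiperiodicity makes the constant equal to its negative.
\<close>
lemma remainder_1_uniform:
  "uniform_limit {0..1} (remainder 1) (\<lambda>_. 0) (sequentially \<times>\<^sub>F sequentially)"
proof -
  let ?F = "sequentially \<times>\<^sub>F sequentially :: (nat \<times> nat) filter"
  have F: "?F \<noteq> bot" by (simp add: prod_filter_eq_bot)
  obtain r where r: "uniform_limit {0..1} (remainder 1) r ?F"
    using remainder_1_uniformly_convergent .
  have lim: "((\<lambda>p. remainder 1 p x) \<longlongrightarrow> r x) ?F" if "x \<in> {0..1}" for x
    using tendsto_uniform_limitI[OF r that] .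
  have cont: "continuous_on {0..1} r"
  proof (rule uniform_limit_theorem[OF _ r F])
    show "\<forall>\<^sub>F p in ?F. continuous_on {0..1} (remainder 1 p)"
      using remainder_deriv[of 0] unfolding One_nat_def
      by (intro always_eventually allI continuous_on_vector_derivative)
  qed
  have const: "r x = r (1/2)" if x: "x \<in> {0<..<1}" for x
  proof -
    obtain d where d: "0 < d" "d < 1/2" and xd: "x \<in> {d..1-d}"
      using interior_margin[of x] x by auto
    have half: "1/2 \<in> {d..1-d}" using d by simp
    have "norm (r x - r (1/2)) \<le> e" if "0 < e" for e
    proof (rule tendsto_upperbound[OF _ _ F])
      show "((\<lambda>p. norm (remainder 1 p x - remainder 1 p (1/2))) \<longlongrightarrow> norm (r x - r (1/2))) ?F"
        using x by (intro tendsto_intros lim) auto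
      have "\<forall>\<^sub>F p in ?F. \<forall>t\<in>{d..1-d}. dist (mode_sum 0 p t) (1/2) < e"
        by (rule uniform_limitD[OF mode_sum_0_locally_uniform[OF d] \<open>0 < e\<close>])
      thus "\<forall>\<^sub>F p in ?F. norm (remainder 1 p x - remainder 1 p (1/2)) \<le> e"
      proof eventually_elim
        case (elim p)
        have "norm (remainder 0 p t) \<le> e" if "t \<in> {d..1-d}" for t
          using elim that by (auto simp: remainder_def dist_norm intro: less_imp_le)
        from norm_diff_le_of_vector_derivative_bound[OF remainder_deriv this xd half]
        have "norm (remainder 1 p x - remainder 1 p (1/2)) \<le> e * \<bar>x - 1/2\<bar>" by simp
        also have "\<dots> \<le> e * 1" using x \<open>0 < e\<close> by (intro mult_left_mono) auto
        finally show ?case by simp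
      qed
    qed
    hence "norm (r x - r (1/2)) \<le> 0" by (rule field_le_epsilon) (simp only: add_0)
    thus ?thesis by simp
  qed
  obtain c where c: "\<And>x. x \<in> {0<..<1} \<Longrightarrow> r x = c"
    using const by blast
  have const': "r x = c" if "x \<in> {0..1}" for x
    using continuous_constant_on_closure[of "{0<..<1::real}" r c x] cont c that by simp
  have "((\<lambda>p. - remainder 1 p 0) \<longlongrightarrow> r 1) ?F"
    using lim[of 1] remainder_antiperiodic[of 0] by simp
  moreover have "((\<lambda>p. - remainder 1 p 0) \<longlongrightarrow> - r 0) ?F"
    by (intro tendsto_minus lim) simp
  ultimately have "r 1 = - r 0" using F tendsto_unique by blast
  hence "c = 0" using const'[of 0] const'[of 1] by simp
  hence "\<forall>x\<in>{0..1}. r x = 0" using const' by simp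
  thus ?thesis
    using r by (simp add: uniform_limit_iff)
qed

lemma mode_sum_uniform:
  "uniform_limit {0..1} (mode_sum (Suc m)) (\<lambda>x. of_real (appell_euler (Suc m) x) / 2)
     (sequentially \<times>\<^sub>F sequentially)"
proof -
  have "uniform_limit {0..1} (remainder (Suc m)) (\<lambda>_. 0) (sequentially \<times>\<^sub>F sequentially)"
    by (induction m) (use remainder_1_uniform remainder_uniform_step in auto)
  thus ?thesis by (simp only: uniform_limit_remainder_iff)
qed

theorem theorem3:
  fixes m :: nat and x :: real
  assumes "0 \<le> x" and "x < 1" and "m \<noteq> 0 \<or> x \<noteq> 0"
  shows "\<exists>S. (\<lambda>n::int. exp (of_int (2 * n + 1) * of_real pi * \<i> * of_real x)
                   / (of_int (2 * n + 1) * of_real pi * \<i>) ^ (m + 1)) bilateral_sums S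
             \<and> complex_of_real (euler_poly m x) = 2 * fact m * S"
proof -
  have "((\<lambda>p. mode_sum m p x) \<longlongrightarrow> of_real (appell_euler m x) / 2) (sequentially \<times>\<^sub>F sequentially)"
  proof (cases m)
    case 0
    obtain d where d: "0 < d" "d < 1/2" and x: "x \<in> {d..1-d}"
      using interior_margin[of x] assms 0 by auto
    from tendsto_uniform_limitI[OF mode_sum_0_locally_uniform[OF d] x] show ?thesis
      by (simp add: 0)
  next
    case (Suc k)
    thus ?thesis
      using tendsto_uniform_limitI[OF mode_sum_uniform[of k], of x] assms by simp
  qed
  hence "(\<lambda>n. mode m n x) bilateral_sums (of_real (appell_euler m x) / 2)"
    by (simp add: bilateral_sums_def mode_sum_def case_prod_unfold)
  moreover have "complex_of_real (euler_poly m x) = 2 * fact m * (of_real (appell_euler m x) / 2)"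
    by (simp add: appell_euler_def)
  ultimately show ?thesis
    unfolding mode_def freq_def by blast
qed

end
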